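(* Let $B=\varprojlim B_n$ be a commutative ring, $G$ a finite group, and $\rho:G\to\operatorname{Aut}^c_B(B[[x]])$ a continuous action of $G$ on $B[[x]]$. Write $x^g=\rho(g)(x)=\sum_{j\geq 0}\lambda^g_jx^j$. Suppose that for all $g\in G\setminus\{e\}$ the elements $\lambda^g_0\in B$ are not zero-divisors. Then the subring of invariants is given by $$B[[x]]^{G}=B\Big[\Big[\prod_{g\in G}x^g\Big]\Big].$$
   Context: For a commutative ring $B=\varprojlim B_n$ (inverse limit of commutative rings), a continuous $B$-homomorphism $\sigma:B[[x]]\to B[[x]]$ is a map such that for any $\varepsilon(x)\in B[[x]]$ one has $\sigma(\varepsilon(x))=\varepsilon(x^\sigma)$, where $x^\sigma=\sum_{j\geq0}\lambda^\sigma_jx^j\in B[[x]]$ and $B$ is complete with respect to $\lambda^\sigma_0$, meaning that $(\lambda^\sigma_0)^n=0$ in $B_n$ for all $n$. If $\lambda_1^\sigma\in B$ is invertible, then $\sigma$ has an inverse which is also a continuous $B$-homomorphism, and $\sigma$ is called a continuous $B$-automorphism. Continuous $B$-automorphisms form a group $\operatorname{Aut}^c_B(B[[x]])$ under composition. A continuous action of a group $G$ on $B[[x]]$ is a group homomorphism $\rho:G\to\operatorname{Aut}^c_B(B[[x]])$. Since $x^e=x$, the element $\prod_{g\in G}x^g$ is divisible by $x$, and $B[[\prod_{g}x^g]]$ denotes the subring of $B[[x]]$ of all power series in $\prod_g x^g$ with coefficients in $B$. *)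

theory Defs
  imports "HOL-Algebra.Algebra" "HOL-Algebra.Algebraic_Closure_Type"
    "HOL-Computational_Algebra.Formal_Power_Series"
begin

text \<open>
  The rings \<open>B\<^sub>n\<close> are indexed by \<open>n \<ge> 1\<close>; the values of all families at \<open>0\<close> are irrelevant.
  (An index \<open>n = 0\<close> would be forced to carry the zero ring by the condition
  \<open>\<lambda>\<^sub>0 ^ n = 0\<close> in \<open>B\<^sub>n\<close> below.)
\<close>

definition inverse_system :: "(nat \<Rightarrow> 'c ring) \<Rightarrow> (nat \<Rightarrow> 'c \<Rightarrow> 'c) \<Rightarrow> bool" where
  "inverse_system Bs \<phi> \<longleftrightarrow>
     (\<forall>n\<ge>1. cring (Bs n) \<and> \<phi> n \<in> ring_hom (Bs (Suc n)) (Bs n))"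

text \<open>
  The ring \<open>'b\<close> together with the projections \<open>\<pi> n\<close> is the inverse limit of the system:
  via the projections, its elements correspond bijectively to the compatible sequences.
\<close>

definition is_inverse_limit ::
    "(nat \<Rightarrow> 'c ring) \<Rightarrow> (nat \<Rightarrow> 'c \<Rightarrow> 'c) \<Rightarrow> (nat \<Rightarrow> 'b::comm_ring_1 \<Rightarrow> 'c) \<Rightarrow> bool" where
  "is_inverse_limit Bs \<phi> \<pi> \<longleftrightarrow>
     inverse_system Bs \<phi> \<and>
     (\<forall>n\<ge>1. \<pi> n \<in> ring_hom ring_of_type_algebra (Bs n)) \<and>
     (\<forall>n\<ge>1. \<forall>b. \<phi> n (\<pi> (Suc n) b) = \<pi> n b) \<and>
     (\<forall>s. (\<forall>n\<ge>1. s n \<in> carrier (Bs n) \<and> \<phi> n (s (Suc n)) = s n) \<longrightarrow>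
          (\<exists>!b. \<forall>n\<ge>1. \<pi> n b = s n))"

text \<open>Convergence in the inverse limit topology, each \<open>B\<^sub>n\<close> being discrete.\<close>

definition converges_to :: "(nat \<Rightarrow> 'b \<Rightarrow> 'c) \<Rightarrow> (nat \<Rightarrow> 'b) \<Rightarrow> 'b \<Rightarrow> bool" where
  "converges_to \<pi> a l \<longleftrightarrow> (\<forall>n\<ge>1. eventually (\<lambda>m. \<pi> n (a m) = \<pi> n l) sequentially)"

text \<open>
  \<open>substitutes_to \<pi> e s f\<close> says \<open>f = e(s)\<close>, i.e. the series \<open>\<Sum>j. e\<^sub>j s^j\<close> converges to \<open>f\<close>
  coefficientwise in \<open>B\<close>. The library's \<open>fps_compose\<close> cannot be used for this, since
  the constant term of \<open>s\<close> need not vanish.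
\<close>

definition substitutes_to ::
    "(nat \<Rightarrow> 'b::comm_ring_1 \<Rightarrow> 'c) \<Rightarrow> 'b fps \<Rightarrow> 'b fps \<Rightarrow> 'b fps \<Rightarrow> bool" where
  "substitutes_to \<pi> e s f \<longleftrightarrow>
     (\<forall>k. converges_to \<pi> (\<lambda>m. \<Sum>j<m. fps_nth e j * fps_nth (s ^ j) k) (fps_nth f k))"

definition complete_wrt :: "(nat \<Rightarrow> 'c ring) \<Rightarrow> (nat \<Rightarrow> 'b::comm_ring_1 \<Rightarrow> 'c) \<Rightarrow> 'b \<Rightarrow> bool" where
  "complete_wrt Bs \<pi> l \<longleftrightarrow> (\<forall>n\<ge>1. \<pi> n (l ^ n) = \<zero>\<^bsub>Bs n\<^esub>)"

text \<open>The series \<open>x\<^sup>\<sigma>\<close> is \<open>\<sigma> fps_X\<close>, and \<open>\<lambda>\<^sub>j\<^sup>\<sigma>\<close> is its \<open>j\<close>-th coefficient.\<close>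

definition continuous_hom ::
    "(nat \<Rightarrow> 'c ring) \<Rightarrow> (nat \<Rightarrow> 'b::comm_ring_1 \<Rightarrow> 'c) \<Rightarrow> ('b fps \<Rightarrow> 'b fps) \<Rightarrow> bool" where
  "continuous_hom Bs \<pi> \<sigma> \<longleftrightarrow>
     complete_wrt Bs \<pi> (fps_nth (\<sigma> fps_X) 0) \<and>
     (\<forall>e. substitutes_to \<pi> e (\<sigma> fps_X) (\<sigma> e))"

definition continuous_aut ::
    "(nat \<Rightarrow> 'c ring) \<Rightarrow> (nat \<Rightarrow> 'b::comm_ring_1 \<Rightarrow> 'c) \<Rightarrow> ('b fps \<Rightarrow> 'b fps) \<Rightarrow> bool" where
  "continuous_aut Bs \<pi> \<sigma> \<longleftrightarrow>
     continuous_hom Bs \<pi> \<sigma> \<and> fps_nth (\<sigma> fps_X) 1 dvd 1"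

definition Aut_c ::
    "(nat \<Rightarrow> 'c ring) \<Rightarrow> (nat \<Rightarrow> 'b::comm_ring_1 \<Rightarrow> 'c) \<Rightarrow> ('b fps \<Rightarrow> 'b fps) monoid" where
  "Aut_c Bs \<pi> = \<lparr>carrier = {\<sigma>. continuous_aut Bs \<pi> \<sigma>}, monoid.mult = (\<circ>), one = id\<rparr>"

text \<open>
  For an arbitrary inverse system, closure of \<^term>\<open>Aut_c\<close> under composition is not guaranteed
  by the condition \<open>\<lambda>\<^sub>0 ^ n = 0\<close> in \<open>B\<^sub>n\<close>. The notion of an action does not depend on it:
  \<^term>\<open>hom\<close> asks for \<open>\<rho> g \<in> carrier (Aut_c Bs \<pi>)\<close> and \<open>\<rho> (g h) = \<rho> g \<circ> \<rho> h\<close>.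
\<close>

definition continuous_action ::
    "('g, 'm) monoid_scheme \<Rightarrow> (nat \<Rightarrow> 'c ring) \<Rightarrow> (nat \<Rightarrow> 'b::comm_ring_1 \<Rightarrow> 'c)
      \<Rightarrow> ('g \<Rightarrow> 'b fps \<Rightarrow> 'b fps) \<Rightarrow> bool" where
  "continuous_action G Bs \<pi> \<rho> \<longleftrightarrow> \<rho> \<in> hom G (Aut_c Bs \<pi>)"

definition is_zero_divisor :: "'b::comm_ring_1 \<Rightarrow> bool" where
  "is_zero_divisor a \<longleftrightarrow> (\<exists>b. b \<noteq> 0 \<and> a * b = 0)"

definition invariant_series ::
    "('g, 'm) monoid_scheme \<Rightarrow> ('g \<Rightarrow> 'b::comm_ring_1 fps \<Rightarrow> 'b fps) \<Rightarrow> 'b fps set" where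
  "invariant_series G \<rho> = {f. \<forall>g\<in>carrier G. \<rho> g f = f}"

text \<open>
  The subring \<open>B[[y]]\<close> of all power series in \<open>y\<close>; only meaningful when \<open>y\<close> is divisible by \<open>x\<close>,
  which is what \<open>fps_compose\<close> requires.
\<close>

definition power_series_in :: "'b::comm_ring_1 fps \<Rightarrow> 'b fps set" where
  "power_series_in y = range (\<lambda>c. fps_compose c y)"

end

theory Submission
  imports Defs
begin

text \<open>
  Write \<open>s = x\<^sup>\<sigma>\<close>. Everything about a continuous homomorphism \<open>\<sigma>\<close> follows from one functional
  equation, \<open>\<sigma>(a) = a\<^sub>0 + s \<cdot> \<sigma>(a')\<close> for \<open>a = a\<^sub>0 + x \<cdot> a'\<close>
  (\<open>substitution_recursion\<close>), because the powers of \<open>s\<close> tend to \<open>0\<close>: a defect \<open>D\<close> (of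
  additivity, of multiplicativity) with \<open>D(a) = s \<cdot> D(a')\<close> is divisible by all powers of
  \<open>s\<close> and hence vanishes. So \<open>\<sigma>\<close> is a ring homomorphism over \<open>B\<close>. If \<open>\<lambda>\<^sub>1\<close> is a unit,
  \<open>\<sigma>\<close> is injective (\<open>substitution_injective\<close>). The idempotent \<open>\<rho>(\<one>)\<close> is therefore the
  identity, so that all \<open>\<rho>(g)\<close> are ring automorphisms over \<open>B\<close>, and \<open>x\<^sup>g = x\<close> for \<open>g = \<one>\<close>.

  Let \<open>y\<close> be the product of all \<open>x\<^sup>g\<close>; it is invariant and divisible by \<open>x\<close>. If \<open>f\<close> is
  invariant, then \<open>f - f\<^sub>0\<close> is invariant and divisible by \<open>x\<close>, hence by every \<open>x\<^sup>g\<close>.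
  Being divisible by \<open>x\<^sup>g\<close> means that the constant term vanishes after applying
  \<open>\<rho>(g\<inverse>)\<close>, and for \<open>h \<noteq> g\<close> this automorphism takes \<open>x\<^sup>h\<close> to a translate of \<open>x\<close> whose
  constant term is not a zero-divisor. This lets the factors \<open>x\<^sup>g\<close> be split off one after
  another (\<open>prod_dvd\<close>), so \<open>f - f\<^sub>0 = y \<cdot> f\<^sub>1\<close>. As \<open>y\<close> is not a zero-divisor, \<open>f\<^sub>1\<close> is
  invariant as well, and iteration expands \<open>f\<close> as a power series in \<open>y\<close>. Conversely,
  \<open>c(y) = c\<^sub>0 + y \<cdot> c'(y)\<close> shows that the defect \<open>\<rho>(g)(c(y)) - c(y)\<close> is divisible by all
  powers of \<open>y\<close>, so that power series in \<open>y\<close> are invariant.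
\<close>

section \<open>Ideals and coefficients of power series\<close>

definition is_ideal :: "'a::comm_ring_1 set \<Rightarrow> bool" where
  "is_ideal I \<longleftrightarrow> 0 \<in> I \<and> (\<forall>a\<in>I. \<forall>b\<in>I. a + b \<in> I) \<and> (\<forall>r. \<forall>a\<in>I. r * a \<in> I)"

lemma is_idealD:
  assumes "is_ideal I"
  shows ideal_zero: "0 \<in> I"
    and ideal_add: "a \<in> I \<Longrightarrow> b \<in> I \<Longrightarrow> a + b \<in> I"
    and ideal_mult: "a \<in> I \<Longrightarrow> r * a \<in> I"
    and ideal_mult_right: "a \<in> I \<Longrightarrow> a * r \<in> I"
  using assms by (auto simp: is_ideal_def mult.commute[of a r])

lemma ideal_diff:
  assumes "is_ideal I" "a \<in> I" "b \<in> I"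
  shows "a - b \<in> I"
  using ideal_add[OF assms(1,2) ideal_mult[OF assms(1,3), of "-1"]] by simp

lemma ideal_sum:
  assumes "is_ideal I" "\<And>i. i \<in> S \<Longrightarrow> f i \<in> I"
  shows "sum f S \<in> I"
  using assms(2) by (induction S rule: infinite_finite_induct)
    (auto simp: ideal_zero[OF assms(1)] intro: ideal_add[OF assms(1)])

lemma is_ideal_multiples_plus:
  assumes "is_ideal I"
  shows "is_ideal {a * b + z | b z. z \<in> I}"
  unfolding is_ideal_def
proof (intro conjI ballI allI)
  show "0 \<in> {a * b + z | b z. z \<in> I}"
    using ideal_zero[OF assms] by (auto intro!: exI[of _ 0])
next
  fix u v assume "u \<in> {a * b + z | b z. z \<in> I}" "v \<in> {a * b + z | b z. z \<in> I}"
  then obtain b z c w where "u = a * b + z" "v = a * c + w" "z \<in> I" "w \<in> I" by auto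
  then show "u + v \<in> {a * b + z | b z. z \<in> I}"
    using ideal_add[OF assms, of z w]
    by (intro CollectI exI[of _ "b + c"] exI[of _ "z + w"]) (simp add: distrib_left)
next
  fix r u assume "u \<in> {a * b + z | b z. z \<in> I}"
  then obtain b z where "u = a * b + z" "z \<in> I" by auto
  then show "r * u \<in> {a * b + z | b z. z \<in> I}"
    using ideal_mult[OF assms, of z r]
    by (intro CollectI exI[of _ "r * b"] exI[of _ "r * z"]) (simp add: distrib_left mult_ac)
qed

text \<open>
  With \<open>I\<close> ranging over the kernels of \<open>B \<rightarrow> B\<^sub>n\<close>, these ideals form a basis of neighbourhoods of
  \<open>0\<close> for coefficientwise convergence of power series.
\<close>

definition low_coeffs_in :: "nat \<Rightarrow> 'a::comm_ring_1 set \<Rightarrow> 'a fps set" where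
  "low_coeffs_in k I = {f. \<forall>i<k. fps_nth f i \<in> I}"

lemma is_ideal_low_coeffs_in:
  assumes "is_ideal I"
  shows "is_ideal (low_coeffs_in k I)"
  unfolding is_ideal_def low_coeffs_in_def
  by (auto simp: fps_mult_nth
      intro!: ideal_zero[OF assms] ideal_add[OF assms] ideal_sum[OF assms] ideal_mult[OF assms])

lemma fps_nth_prod_0: "fps_nth (prod f S) 0 = (\<Prod>i\<in>S. fps_nth (f i) 0)"
  by (induction S rule: infinite_finite_induct) auto

lemma fps_split: "f = fps_const (fps_nth f 0) + fps_X * fps_shift 1 f"
  for f :: "'a::comm_ring_1 fps"
  by (rule fps_ext) simp

lemma fps_shift_1_const: "fps_shift 1 (fps_const c) = 0"
  by (rule fps_ext) simp

lemma fps_shift_1_X_mult: "fps_shift 1 (fps_X * f) = f"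
  for f :: "'a::comm_ring_1 fps"
  by (rule fps_ext) simp

lemma fps_X_dvd_iff: "fps_X dvd f \<longleftrightarrow> fps_nth f 0 = 0"
  for f :: "'a::comm_ring_1 fps"
proof
  assume "fps_nth f 0 = 0"
  then have "f = fps_X * fps_shift 1 f" using fps_split[of f] by simp
  then show "fps_X dvd f" by (rule dvdI)
qed auto

lemma fps_eq_zero_if_power_dvd:
  fixes f y :: "'a::comm_ring_1 fps"
  assumes "\<And>m. y ^ m dvd f" "fps_nth y 0 = 0"
  shows "f = 0"
proof (rule fps_ext)
  fix k
  obtain r where f: "f = y ^ Suc k * r" using assms(1) by blast
  obtain u where "y = fps_X * u" using assms(2) fps_X_dvd_iff by blast
  then have "f = fps_X ^ Suc k * (u ^ Suc k * r)" by (simp add: f power_mult_distrib mult_ac)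
  then show "fps_nth f k = fps_nth 0 k" by (simp only: fps_X_power_mult_nth) simp
qed

text \<open>
  The recursion principle behind all vanishing arguments: a defect that reproduces itself up to
  a factor \<open>y\<close> is divisible by every power of \<open>y\<close>.
\<close>

lemma power_dvd_of_recursion:
  fixes D :: "'a \<Rightarrow> 'r::comm_monoid_mult"
  assumes "\<And>a. D a = y * D (nxt a)"
  shows "y ^ m dvd D a"
proof (induction m arbitrary: a)
  case (Suc m)
  then show ?case using assms[of a] mult_dvd_mono[of y y "y ^ m" "D (nxt a)"] by simp
qed simp

section \<open>Substitution homomorphisms\<close>

text \<open>
  The inverse limit enters through the kernels \<open>K n\<close> of the projections \<open>B \<rightarrow> B\<^sub>n\<close>: they are
  ideals with intersection \<open>0\<close>, and convergence in \<open>B\<close> is being eventually congruent to the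
  limit modulo each of them.
\<close>

locale substitution =
  fixes K :: "nat \<Rightarrow> 'b::comm_ring_1 set" and s :: "'b fps" and \<sigma> :: "'b fps \<Rightarrow> 'b fps"
  assumes ideal: "n \<ge> 1 \<Longrightarrow> is_ideal (K n)"
    and separated: "(\<And>n. n \<ge> 1 \<Longrightarrow> b \<in> K n) \<Longrightarrow> b = 0"
    and nilpotent: "n \<ge> 1 \<Longrightarrow> fps_nth s 0 ^ n \<in> K n"
    and limit: "n \<ge> 1 \<Longrightarrow> eventually (\<lambda>m.
      (\<Sum>j<m. fps_nth e j * fps_nth (s ^ j) k) - fps_nth (\<sigma> e) k \<in> K n) sequentially"
begin

lemmas ideal_low = is_ideal_low_coeffs_in[OF ideal]

lemma fps_separated:
  assumes "\<And>n k. n \<ge> 1 \<Longrightarrow> f \<in> low_coeffs_in k (K n)"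
  shows "f = 0"
proof (rule fps_ext)
  fix k
  have "fps_nth f k \<in> K n" if "n \<ge> 1" for n
    using assms[OF that, of "Suc k"] by (simp add: low_coeffs_in_def)
  then show "fps_nth f k = fps_nth 0 k" using separated by simp
qed

text \<open>
  In the binomial expansion of \<open>(\<lambda>\<^sub>0 + x u)^(n + k)\<close> every term contains \<open>\<lambda>\<^sub>0^n\<close> or \<open>x^k\<close>.
\<close>

lemma power_in_low_coeffs:
  assumes n: "n \<ge> 1"
  shows "s ^ (n + k) \<in> low_coeffs_in k (K n)"
proof -
  define u l where "u = fps_shift 1 s" and "l = fps_nth s 0"
  have s: "s = fps_const l + fps_X * u" unfolding u_def l_def by (rule fps_split)
  have l: "fps_const l ^ i \<in> low_coeffs_in k (K n)" if "n \<le> i" for i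
  proof -
    have "l ^ i = l ^ (i - n) * l ^ n" using that by (simp flip: power_add)
    then have "l ^ i \<in> K n" using ideal_mult[OF ideal[OF n] nilpotent[OF n]] by (simp add: l_def)
    then show ?thesis
      using ideal_zero[OF ideal[OF n]] by (auto simp: low_coeffs_in_def fps_const_power fps_nth_fps_const)
  qed
  have X: "(fps_X * u) ^ i \<in> low_coeffs_in k (K n)" if "k \<le> i" for i
    using that ideal_zero[OF ideal[OF n]]
    by (auto simp: low_coeffs_in_def power_mult_distrib fps_X_power_mult_nth)
  show ?thesis unfolding s binomial_ring
  proof (rule ideal_sum[OF ideal_low[OF n]])
    fix i
    show "of_nat (n + k choose i) * fps_const l ^ i * (fps_X * u) ^ (n + k - i)
        \<in> low_coeffs_in k (K n)"
    proof (cases "n \<le> i")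
      case True
      then show ?thesis
        by (intro ideal_mult_right[OF ideal_low[OF n]] ideal_mult[OF ideal_low[OF n]] l)
    next
      case False
      then show ?thesis by (intro ideal_mult[OF ideal_low[OF n]] X) simp
    qed
  qed
qed

lemma zero_if_power_dvd:
  assumes "\<And>m. s ^ m dvd f"
  shows "f = 0"
proof (rule fps_separated)
  fix n k :: nat assume n: "n \<ge> 1"
  obtain r where "f = s ^ (n + k) * r" using assms by blast
  then show "f \<in> low_coeffs_in k (K n)"
    using ideal_mult_right[OF ideal_low[OF n] power_in_low_coeffs[OF n]] by simp
qed

lemma limit_low_coeffs:
  assumes "n \<ge> 1"
  shows "eventually (\<lambda>m. (\<Sum>j<m. fps_const (fps_nth e j) * s ^ j) - \<sigma> e
    \<in> low_coeffs_in k (K n)) sequentially"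
proof -
  have "eventually (\<lambda>m. \<forall>i\<in>{..<k}.
      (\<Sum>j<m. fps_nth e j * fps_nth (s ^ j) i) - fps_nth (\<sigma> e) i \<in> K n) sequentially"
    by (rule eventually_ball_finite) (auto intro: limit[OF assms])
  then show ?thesis by (rule eventually_mono) (auto simp: low_coeffs_in_def fps_sum_nth)
qed

text \<open>
  The partial sums of \<open>\<Sum>j. e\<^sub>j s^j\<close> satisfy the equation exactly, up to a shift of their length;
  limits are unique because the \<open>K n\<close> intersect in \<open>0\<close>.
\<close>

lemma substitution_recursion: "\<sigma> e = fps_const (fps_nth e 0) + s * \<sigma> (fps_shift 1 e)"
proof -
  let ?e = "fps_shift 1 e"
  let ?T = "\<lambda>e m. \<Sum>j<m. fps_const (fps_nth e j) * s ^ j"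
  let ?c = "fps_const (fps_nth e 0)"
  have T: "?T e (Suc m) = ?c + s * ?T ?e m" for m
    by (simp only: sum.lessThan_Suc_shift) (simp add: sum_distrib_left mult_ac)
  have "?c + s * \<sigma> ?e - \<sigma> e = 0"
  proof (rule fps_separated)
    fix n k :: nat assume n: "n \<ge> 1"
    note I = ideal_low[OF n, of k]
    obtain m where m: "?T e (Suc m) - \<sigma> e \<in> low_coeffs_in k (K n)"
        "?T ?e m - \<sigma> ?e \<in> low_coeffs_in k (K n)"
      using eventually_conj[OF eventually_sequentially_Suc[THEN iffD2, OF limit_low_coeffs[OF n, of e k]]
          limit_low_coeffs[OF n, of ?e k]]
      by (auto dest!: eventually_happens)
    have "?c + s * \<sigma> ?e - \<sigma> e = (?T e (Suc m) - \<sigma> e) - s * (?T ?e m - \<sigma> ?e)"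
      unfolding T by (simp add: algebra_simps)
    then show "?c + s * \<sigma> ?e - \<sigma> e \<in> low_coeffs_in k (K n)"
      using ideal_diff[OF I m(1) ideal_mult[OF I m(2)]] by (simp only:)
  qed
  then show ?thesis by simp
qed

lemma substitution_zero: "\<sigma> 0 = 0"
proof -
  have "s ^ m dvd (\<lambda>_::unit. \<sigma> 0) ()" for m
    by (rule power_dvd_of_recursion[where D = "\<lambda>_. \<sigma> 0" and nxt = id])
      (use substitution_recursion[of 0] in simp)
  then show ?thesis using zero_if_power_dvd by simp
qed

lemma substitution_const: "\<sigma> (fps_const c) = fps_const c"
  using substitution_recursion[of "fps_const c"]
  by (simp only: fps_shift_1_const) (simp add: substitution_zero)

lemma substitution_X_mult: "\<sigma> (fps_X * e) = s * \<sigma> e"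
  using substitution_recursion[of "fps_X * e"] by (simp only: fps_shift_1_X_mult) simp

lemma substitution_add: "\<sigma> (e + f) = \<sigma> e + \<sigma> f"
proof -
  let ?D = "\<lambda>(e, f). \<sigma> (e + f) - \<sigma> e - \<sigma> f"
  have "s ^ m dvd ?D (e, f)" for m
  proof (rule power_dvd_of_recursion[where D = ?D and nxt = "map_prod (fps_shift 1) (fps_shift 1)"])
    fix p :: "'b fps \<times> 'b fps"
    obtain e f where p: "p = (e, f)" by (rule prod.exhaust)
    show "?D p = s * ?D (map_prod (fps_shift 1) (fps_shift 1) p)"
      unfolding p map_prod_simp prod.case
      by (subst (1 2 3) substitution_recursion)
        (simp add: algebra_simps fps_shift_add flip: fps_const_add)
  qed
  then show ?thesis using zero_if_power_dvd[of "?D (e, f)"] by (simp add: algebra_simps)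
qed

lemma substitution_const_mult: "\<sigma> (fps_const c * e) = fps_const c * \<sigma> e"
proof -
  let ?D = "\<lambda>e. \<sigma> (fps_const c * e) - fps_const c * \<sigma> e"
  have "s ^ m dvd ?D e" for m
  proof (rule power_dvd_of_recursion[where D = ?D and nxt = "fps_shift 1"])
    fix e
    have "fps_shift 1 (fps_const c * e) = fps_const c * fps_shift 1 e" by (rule fps_ext) simp
    then show "?D e = s * ?D (fps_shift 1 e)"
      by (subst (1 2) substitution_recursion) (simp add: algebra_simps flip: fps_const_mult)
  qed
  then show ?thesis using zero_if_power_dvd[of "?D e"] by simp
qed

lemma substitution_mult: "\<sigma> (e * f) = \<sigma> e * \<sigma> f"
proof -
  let ?D = "\<lambda>e. \<sigma> (e * f) - \<sigma> e * \<sigma> f"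
  have "s ^ m dvd ?D e" for m
  proof (rule power_dvd_of_recursion[where D = ?D and nxt = "fps_shift 1"])
    fix e
    have "\<sigma> (e * f) = \<sigma> (fps_const (fps_nth e 0) * f + fps_X * (fps_shift 1 e * f))"
      by (subst fps_split[of e]) (simp add: algebra_simps)
    also have "\<dots> = fps_const (fps_nth e 0) * \<sigma> f + s * \<sigma> (fps_shift 1 e * f)"
      by (simp add: substitution_add substitution_const_mult substitution_X_mult)
    finally show "?D e = s * ?D (fps_shift 1 e)"
      by (subst (2) substitution_recursion) (simp add: algebra_simps)
  qed
  then show ?thesis using zero_if_power_dvd[of "?D e"] by simp
qed

lemma substitution_coeffs_in:
  assumes J: "is_ideal J" "K n \<subseteq> J" and n: "n \<ge> 1" and e: "\<And>i. fps_nth e i \<in> J"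
  shows "fps_nth (\<sigma> e) i \<in> J"
proof -
  obtain m where m: "(\<Sum>j<m. fps_nth e j * fps_nth (s ^ j) i) - fps_nth (\<sigma> e) i \<in> K n"
    using limit[OF n, of e i] by (auto dest!: eventually_happens)
  have "(\<Sum>j<m. fps_nth e j * fps_nth (s ^ j) i) \<in> J"
    by (intro ideal_sum ideal_mult_right J e)
  from ideal_diff[OF J(1) this subsetD[OF J(2) m]] show ?thesis by simp
qed

text \<open>
  If \<open>\<lambda>\<^sub>1\<close> is a unit, then modulo \<open>\<lambda>\<^sub>0\<close> the series \<open>s\<close> is \<open>x\<close> times a unit, and the coefficients
  of \<open>e\<close> can be recovered from those of \<open>\<sigma>(e)\<close> one by one. This argument works on every layer
  \<open>J / J'\<close> that is killed by \<open>\<lambda>\<^sub>0\<close>.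
\<close>

lemma substitution_reflects_coeffs:
  assumes unit: "fps_nth s 1 dvd 1" and n: "n \<ge> 1"
    and J: "is_ideal J" "K n \<subseteq> J" and J': "is_ideal J'"
    and layer: "\<And>a. a \<in> J \<Longrightarrow> fps_nth s 0 * a \<in> J'"
    and e: "\<And>i. fps_nth e i \<in> J" and \<sigma>e: "\<And>i. fps_nth (\<sigma> e) i \<in> J'"
  shows "fps_nth e i \<in> J'"
proof -
  define l u where "l = fps_nth s 0" and "u = fps_shift 1 s"
  have s: "s = fps_const l + fps_X * u" unfolding u_def l_def by (rule fps_split)
  have "fps_nth u 0 dvd 1" using unit by (simp add: u_def)
  then obtain v0 where "fps_nth u 0 * v0 = 1" by (metis dvdE)
  then obtain v where v: "v * u = 1"
    using fps_right_inverse[of u v0] by (metis mult.commute)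
  show ?thesis using e \<sigma>e
  proof (induction i arbitrary: e)
    case 0
    let ?f = "\<sigma> (fps_shift 1 e)"
    have "fps_nth ?f 0 \<in> J" using substitution_coeffs_in[OF J n] 0(1) by simp
    then have "l * fps_nth ?f 0 \<in> J'" unfolding l_def by (rule layer)
    moreover have "fps_nth (\<sigma> e) 0 = fps_nth e 0 + l * fps_nth ?f 0"
      by (subst substitution_recursion) (simp add: l_def)
    ultimately show ?case using ideal_diff[OF J' 0(2)[of 0]] by force
  next
    case (Suc i)
    let ?f = "\<sigma> (fps_shift 1 e)"
    have fJ: "fps_nth ?f j \<in> J" for j using substitution_coeffs_in[OF J n] Suc.prems(1) by simp
    have uf: "fps_nth (u * ?f) j \<in> J'" for j
    proof -
      have "fps_nth (\<sigma> e) (Suc j) = l * fps_nth ?f (Suc j) + fps_nth (u * ?f) j"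
        by (subst substitution_recursion, subst s) (simp add: algebra_simps)
      moreover have "l * fps_nth ?f (Suc j) \<in> J'" unfolding l_def by (intro layer fJ)
      ultimately show ?thesis using ideal_diff[OF J' Suc.prems(2)[of "Suc j"]] by force
    qed
    have "fps_nth ?f j \<in> J'" for j
    proof -
      have "?f = v * (u * ?f)" using v by (simp flip: mult.assoc)
      moreover have "fps_nth (v * (u * ?f)) j \<in> J'"
        unfolding fps_mult_nth[of v] by (intro ideal_sum[OF J'] ideal_mult[OF J'] uf)
      ultimately show ?thesis by simp
    qed
    then have "fps_nth (fps_shift 1 e) i \<in> J'" using Suc.IH[of "fps_shift 1 e"] Suc.prems(1) by simp
    then show ?case by simp
  qed
qed

text \<open>
  The layers are those of the ideals \<open>\<lambda>\<^sub>0^k B + K n\<close>, which decrease from \<open>B\<close> for \<open>k = 0\<close> to \<open>K n\<close>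
  for \<open>k = n\<close>.
\<close>

lemma substitution_zero_iff:
  assumes unit: "fps_nth s 1 dvd 1"
  shows "\<sigma> e = 0 \<longleftrightarrow> e = 0"
proof
  assume \<sigma>e: "\<sigma> e = 0"
  define l where "l = fps_nth s 0"
  have "fps_nth e i \<in> K n" if n: "n \<ge> 1" for n i
  proof -
    define J where "J k = {l ^ k * b + z | b z. z \<in> K n}" for k
    have J: "is_ideal (J k)" for k unfolding J_def by (rule is_ideal_multiples_plus[OF ideal[OF n]])
    have KJ: "K n \<subseteq> J k" for k unfolding J_def by (force intro: exI[of _ 0])
    have "fps_nth e i \<in> J k" for k i
    proof (induction k arbitrary: i)
      case 0
      show ?case unfolding J_def using ideal_zero[OF ideal[OF n]] by (force intro: exI[of _ 0])
    next
      case (Suc k)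
      show ?case
      proof (rule substitution_reflects_coeffs[OF unit n J KJ J _ Suc])
        fix a assume "a \<in> J k"
        then obtain b z where "a = l ^ k * b + z" "z \<in> K n" unfolding J_def by auto
        then have "l * a = l ^ Suc k * b + l * z" "l * z \<in> K n"
          using ideal_mult[OF ideal[OF n], of z l] by (simp_all add: algebra_simps)
        then show "fps_nth s 0 * a \<in> J (Suc k)" unfolding J_def l_def by blast
      qed (use \<sigma>e ideal_zero[OF J] in auto)
    qed
    from this[of i n] obtain b z where "fps_nth e i = l ^ n * b + z" "z \<in> K n"
      unfolding J_def by auto
    then show ?thesis
      using nilpotent[OF n] ideal_add[OF ideal[OF n]] ideal_mult_right[OF ideal[OF n]]
      by (simp add: l_def)
  qed
  then show "e = 0" by (intro fps_ext) (simp add: separated)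
qed (simp add: substitution_zero)

lemma substitution_injective:
  assumes "fps_nth s 1 dvd 1" "\<sigma> e = \<sigma> f"
  shows "e = f"
proof -
  have "\<sigma> (e - f) + \<sigma> f = \<sigma> f" using assms(2) by (simp flip: substitution_add)
  then show ?thesis using substitution_zero_iff[OF assms(1), of "e - f"] by simp
qed

end

section \<open>Power series in a fixed series\<close>

lemma fps_compose_nth_truncate:
  fixes c y :: "'a::comm_ring_1 fps"
  assumes "fps_nth y 0 = 0" "k < m"
  shows "fps_nth (fps_compose c y) k = fps_nth (\<Sum>j<m. fps_const (fps_nth c j) * y ^ j) k"
proof -
  have "(\<Sum>j\<in>{0..k}. fps_nth c j * fps_nth (y ^ j) k)
      = (\<Sum>j<m. fps_nth c j * fps_nth (y ^ j) k)"
    using assms by (intro sum.mono_neutral_left) (auto simp: startsby_zero_power_prefix)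
  then show ?thesis by (simp add: fps_compose_nth fps_sum_nth)
qed

text \<open>
  A coefficient sees only finitely many powers of \<open>y\<close>. For the truncated sums the equation is a
  shift of the summation index, which is valid over any commutative ring.
\<close>

lemma fps_compose_recursion:
  fixes c y :: "'a::comm_ring_1 fps"
  assumes y: "fps_nth y 0 = 0"
  shows "fps_compose c y = fps_const (fps_nth c 0) + y * fps_compose (fps_shift 1 c) y"
proof (rule fps_ext)
  fix k
  let ?T = "\<lambda>c m. \<Sum>j<m. fps_const (fps_nth c j) * y ^ j"
  let ?c = "fps_shift 1 c"
  have T: "?T c (Suc m) = fps_const (fps_nth c 0) + y * ?T ?c m" for m
    by (simp only: sum.lessThan_Suc_shift) (simp add: sum_distrib_left mult_ac)
  have "fps_nth (y * fps_compose ?c y) k = fps_nth (y * ?T ?c (Suc k)) k"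
    unfolding fps_mult_nth by (intro sum.cong refl)
      (simp only: fps_compose_nth_truncate[OF y, of _ "Suc k"] less_Suc_eq_le diff_le_self)
  moreover have "fps_nth (fps_compose c y) k = fps_nth (?T c (Suc (Suc k))) k"
    by (intro fps_compose_nth_truncate y) simp
  ultimately show "fps_nth (fps_compose c y) k
      = fps_nth (fps_const (fps_nth c 0) + y * fps_compose ?c y) k"
    by (simp only: T fps_add_nth)
qed

lemma hom_fixes_power_series_in:
  fixes \<sigma> :: "'a::comm_ring_1 fps \<Rightarrow> 'a fps"
  assumes add: "\<And>e f. \<sigma> (e + f) = \<sigma> e + \<sigma> f" and mult: "\<And>e f. \<sigma> (e * f) = \<sigma> e * \<sigma> f"
    and const: "\<And>c. \<sigma> (fps_const c) = fps_const c"
    and y: "\<sigma> y = y" "fps_nth y 0 = 0"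
    and f: "f \<in> power_series_in y"
  shows "\<sigma> f = f"
proof -
  obtain c where c: "f = fps_compose c y" using f by (auto simp: power_series_in_def)
  let ?D = "\<lambda>c. \<sigma> (fps_compose c y) - fps_compose c y"
  have "y ^ m dvd ?D c" for m
  proof (rule power_dvd_of_recursion[where D = ?D and nxt = "fps_shift 1"])
    fix c
    show "?D c = y * ?D (fps_shift 1 c)"
      by (subst (1 2) fps_compose_recursion[OF y(2)]) (simp add: add mult const y algebra_simps)
  qed
  then show ?thesis using fps_eq_zero_if_power_dvd[of y "?D c"] y(2) c by simp
qed

text \<open>Splitting off constant terms repeatedly yields the coefficients of an expansion in \<open>y\<close>.\<close>

lemma power_series_in_of_recursion:
  fixes y :: "'a::comm_ring_1 fps"
  assumes y: "fps_nth y 0 = 0"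
    and split: "\<And>f. f \<in> S \<Longrightarrow> \<exists>c. \<exists>f'\<in>S. f = fps_const c + y * f'"
    and f: "f \<in> S"
  shows "f \<in> power_series_in y"
proof -
  obtain c r where cr: "\<And>f. f \<in> S \<Longrightarrow> r f \<in> S \<and> f = fps_const (c f) + y * r f"
    using split by metis
  define a where "a = Abs_fps (\<lambda>j. c ((r ^^ j) f))"
  have rS: "(r ^^ j) f \<in> S" for j using cr f by (induction j) auto
  have expand: "f = (\<Sum>j<m. fps_const (fps_nth a j) * y ^ j) + y ^ m * (r ^^ m) f" for m
  proof (induction m)
    case (Suc m)
    have "(r ^^ m) f = fps_const (fps_nth a m) + y * (r ^^ Suc m) f"
      using cr[OF rS[of m]] by (simp add: a_def)
    then have "y ^ m * (r ^^ m) f = y ^ m * (fps_const (fps_nth a m) + y * (r ^^ Suc m) f)"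
      by (rule arg_cong)
    then show ?case using Suc by (simp add: algebra_simps)
  qed simp
  have "f = fps_compose a y"
  proof (rule fps_ext)
    fix k
    have "fps_nth (y ^ Suc k * (r ^^ Suc k) f) k = 0"
      unfolding fps_mult_nth using y by (intro sum.neutral)
        (auto simp: startsby_zero_power_prefix simp del: power_Suc)
    then show "fps_nth f k = fps_nth (fps_compose a y) k"
      by (subst expand[of "Suc k"])
        (simp only: fps_add_nth fps_compose_nth_truncate[OF y lessI] add_0_right)
  qed
  then show ?thesis by (auto simp: power_series_in_def)
qed

section \<open>Invariants of a finite group of automorphisms\<close>

lemma not_zero_divisorD: "\<not> is_zero_divisor a \<Longrightarrow> a * b = 0 \<Longrightarrow> b = 0"
  by (auto simp: is_zero_divisor_def)

lemma prod_not_zero_divisor: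
  assumes "\<And>i. i \<in> S \<Longrightarrow> \<not> is_zero_divisor (f i)"
  shows "\<not> is_zero_divisor (prod f S)"
  using assms
  by (induction S rule: infinite_finite_induct) (auto simp: is_zero_divisor_def mult.assoc)

locale fps_automorphisms = group G for G :: "('g, 'm) monoid_scheme" (structure) +
  fixes \<rho> :: "'g \<Rightarrow> 'b::comm_ring_1 fps \<Rightarrow> 'b fps"
  assumes finite_carrier: "finite (carrier G)"
    and act_add: "g \<in> carrier G \<Longrightarrow> \<rho> g (e + f) = \<rho> g e + \<rho> g f"
    and act_mult: "g \<in> carrier G \<Longrightarrow> \<rho> g (e * f) = \<rho> g e * \<rho> g f"
    and act_const: "g \<in> carrier G \<Longrightarrow> \<rho> g (fps_const c) = fps_const c"
    and act_one: "\<rho> \<one> f = f"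
    and act_comp: "g \<in> carrier G \<Longrightarrow> h \<in> carrier G \<Longrightarrow> \<rho> (g \<otimes> h) f = \<rho> g (\<rho> h f)"
    and regular: "g \<in> carrier G - {\<one>} \<Longrightarrow> \<not> is_zero_divisor (fps_nth (\<rho> g fps_X) 0)"
begin

lemma act_zero: "g \<in> carrier G \<Longrightarrow> \<rho> g 0 = 0"
  using act_const[of g 0] by simp

lemma act_inv: "g \<in> carrier G \<Longrightarrow> \<rho> g (\<rho> (inv g) f) = f" "g \<in> carrier G \<Longrightarrow> \<rho> (inv g) (\<rho> g f) = f"
  by (simp_all add: act_one flip: act_comp)

lemma act_prod: "g \<in> carrier G \<Longrightarrow> \<rho> g (prod f S) = (\<Prod>i\<in>S. \<rho> g (f i))"
  using act_const[of g 1] by (induction S rule: infinite_finite_induct) (auto simp: act_mult)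

text \<open>The automorphism \<open>\<rho> (inv g)\<close> carries divisibility by \<open>x\<^sup>g\<close> to divisibility by \<open>x\<close>.\<close>

lemma translate_dvd_iff:
  assumes g: "g \<in> carrier G"
  shows "\<rho> g fps_X dvd f \<longleftrightarrow> fps_nth (\<rho> (inv g) f) 0 = 0"
proof -
  have "\<rho> g fps_X dvd f \<longleftrightarrow> fps_X dvd \<rho> (inv g) f"
  proof
    assume "\<rho> g fps_X dvd f"
    then show "fps_X dvd \<rho> (inv g) f" using g by (auto simp: act_mult act_inv elim!: dvdE)
  next
    assume "fps_X dvd \<rho> (inv g) f"
    then obtain r where "\<rho> (inv g) f = fps_X * r" by blast
    then have "f = \<rho> g fps_X * \<rho> g r" using act_inv(1)[OF g, of f] g by (simp add: act_mult)
    then show "\<rho> g fps_X dvd f" by simp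
  qed
  then show ?thesis by (simp add: fps_X_dvd_iff)
qed

text \<open>
  The \<open>x\<^sup>g\<close> behave like pairwise non-associated primes: if \<open>x\<^sup>g\<close> divides a product of other
  \<open>x\<^sup>h\<close> with \<open>r\<close>, it divides \<open>r\<close>, since after applying \<open>\<rho> (inv g)\<close> the constant terms of the
  other factors can be cancelled.
\<close>

lemma prod_dvd:
  assumes "S \<subseteq> carrier G" "\<And>g. g \<in> S \<Longrightarrow> \<rho> g fps_X dvd f"
  shows "(\<Prod>g\<in>S. \<rho> g fps_X) dvd f"
  using assms
proof (induction S rule: infinite_finite_induct)
  case (insert g S)
  then have g: "g \<in> carrier G" and S: "\<And>h. h \<in> S \<Longrightarrow> h \<in> carrier G" by auto
  obtain r where r: "f = (\<Prod>h\<in>S. \<rho> h fps_X) * r" using insert by (auto elim: dvdE)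
  have "\<rho> (inv g) f = (\<Prod>h\<in>S. \<rho> (inv g \<otimes> h) fps_X) * \<rho> (inv g) r"
    using g S by (simp add: r act_mult act_prod act_comp)
  then have "(\<Prod>h\<in>S. fps_nth (\<rho> (inv g \<otimes> h) fps_X) 0) * fps_nth (\<rho> (inv g) r) 0 = 0"
    using translate_dvd_iff[OF g, of f] insert.prems by (simp add: fps_nth_prod_0)
  moreover have "\<not> is_zero_divisor (\<Prod>h\<in>S. fps_nth (\<rho> (inv g \<otimes> h) fps_X) 0)"
  proof (rule prod_not_zero_divisor, rule regular)
    fix h assume "h \<in> S"
    then have "h \<in> carrier G" "h \<noteq> g" using S insert.hyps by auto
    then show "inv g \<otimes> h \<in> carrier G - {\<one>}" using g inv_equality[of "inv g" h] by auto
  qed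
  ultimately have "\<rho> g fps_X dvd r" using translate_dvd_iff[OF g] not_zero_divisorD by blast
  then show ?case using insert.hyps by (auto simp: r mult_ac intro: mult_dvd_mono elim!: dvdE)
qed auto

lemma translate_not_zero_divisor:
  assumes g: "g \<in> carrier G"
  shows "\<not> is_zero_divisor (\<rho> g fps_X)"
proof -
  have "f = 0" if "\<rho> g fps_X * f = 0" for f
  proof -
    have "fps_X * \<rho> (inv g) f = \<rho> (inv g) (\<rho> g fps_X * f)" using g by (simp add: act_mult act_inv)
    also have "\<dots> = 0" using g that by (simp add: act_zero)
    finally have X: "fps_X * \<rho> (inv g) f = 0" .
    have "\<rho> (inv g) f = 0"
    proof (rule fps_ext)
      fix k
      show "fps_nth (\<rho> (inv g) f) k = fps_nth 0 k"
        using arg_cong[OF X, of "\<lambda>h. fps_nth h (Suc k)"] by simp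
    qed
    then show ?thesis using act_inv(1)[OF g, of f] g by (simp add: act_zero)
  qed
  then show ?thesis by (auto simp: is_zero_divisor_def)
qed

definition norm_X :: "'b fps" where
  "norm_X = (\<Prod>g\<in>carrier G. \<rho> g fps_X)"

lemma norm_X_nth_0: "fps_nth norm_X 0 = 0"
proof -
  have "\<rho> \<one> fps_X dvd norm_X" unfolding norm_X_def by (intro dvd_prodI finite_carrier) simp
  then show ?thesis by (simp add: act_one fps_X_dvd_iff)
qed

lemma norm_X_invariant:
  assumes h: "h \<in> carrier G"
  shows "\<rho> h norm_X = norm_X"
proof -
  have "\<rho> h norm_X = (\<Prod>g\<in>carrier G. \<rho> (h \<otimes> g) fps_X)"
    using h by (simp add: norm_X_def act_prod act_comp)
  also have "\<dots> = norm_X" unfolding norm_X_def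
    using h by (intro prod.reindex_bij_witness[of _ "\<lambda>g. inv h \<otimes> g" "\<lambda>g. h \<otimes> g"])
      (auto simp flip: m_assoc)
  finally show ?thesis .
qed

lemma invariant_split:
  assumes f: "f \<in> invariant_series G \<rho>"
  shows "\<exists>c. \<exists>f'\<in>invariant_series G \<rho>. f = fps_const c + norm_X * f'"
proof -
  define c where "c = fps_const (fps_nth f 0)"
  have inv_f: "\<rho> g f = f" if "g \<in> carrier G" for g using f that by (simp add: invariant_series_def)
  have fc: "\<rho> g (f - c) = f - c" if "g \<in> carrier G" for g
    using act_add[OF that, of "f - c" c] that by (simp add: inv_f c_def act_const eq_diff_eq)
  have "norm_X dvd f - c" unfolding norm_X_def
    by (rule prod_dvd) (simp_all add: translate_dvd_iff fc, simp add: c_def)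
  then obtain f' where f': "f - c = norm_X * f'" by blast
  have "\<rho> g f' = f'" if g: "g \<in> carrier G" for g
  proof -
    have "norm_X * \<rho> g f' = norm_X * f'"
      using fc[OF g] g by (simp add: f' act_mult norm_X_invariant)
    then have "norm_X * (\<rho> g f' - f') = 0" by (simp add: algebra_simps)
    moreover have "\<not> is_zero_divisor norm_X" unfolding norm_X_def
      by (intro prod_not_zero_divisor translate_not_zero_divisor)
    ultimately show ?thesis using not_zero_divisorD by fastforce
  qed
  then show ?thesis using f' by (auto simp: invariant_series_def c_def algebra_simps)
qed

theorem invariants_eq_power_series_in_norm_X: "invariant_series G \<rho> = power_series_in norm_X"
proof
  show "invariant_series G \<rho> \<subseteq> power_series_in norm_X"
    using power_series_in_of_recursion[OF norm_X_nth_0 invariant_split] by blast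
  show "power_series_in norm_X \<subseteq> invariant_series G \<rho>"
  proof (clarsimp simp: invariant_series_def)
    fix f g assume "f \<in> power_series_in norm_X" "g \<in> carrier G"
    then show "\<rho> g f = f"
      by - (rule hom_fixes_power_series_in[of "\<rho> g" norm_X],
        simp_all add: act_add act_mult act_const norm_X_invariant norm_X_nth_0)
  qed
qed

end

section \<open>Continuous actions\<close>

lemma inverse_limit_ring_hom_cring:
  assumes "is_inverse_limit Bs \<phi> \<pi>" "n \<ge> 1"
  shows "ring_hom_cring (ring_of_type_algebra :: 'b::comm_ring_1 ring) (Bs n) (\<pi> n)"
proof -
  interpret B: cring "Bs n" using assms by (auto simp: is_inverse_limit_def inverse_system_def)
  interpret T: cring "ring_of_type_algebra :: 'b ring" by (rule cring_from_type_algebra)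
  show ?thesis using assms unfolding is_inverse_limit_def by unfold_locales blast
qed

lemma
  fixes \<pi> :: "nat \<Rightarrow> 'b::comm_ring_1 \<Rightarrow> 'c"
  assumes lim: "is_inverse_limit Bs \<phi> \<pi>" and n: "n \<ge> 1"
  shows is_ideal_kernel: "is_ideal {b. \<pi> n b = \<zero>\<^bsub>Bs n\<^esub>}"
    and projection_eqD: "\<pi> n a = \<pi> n b \<Longrightarrow> \<pi> n (a - b) = \<zero>\<^bsub>Bs n\<^esub>"
    and projection_zero: "\<pi> n 0 = \<zero>\<^bsub>Bs n\<^esub>"
    and projection_closed: "\<pi> n a \<in> carrier (Bs n)"
proof -
  interpret P: ring_hom_cring "ring_of_type_algebra :: 'b ring" "Bs n" "\<pi> n"
    by (rule inverse_limit_ring_hom_cring[OF lim n])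
  have closed: "\<pi> n a \<in> carrier (Bs n)" for a
    using P.hom_closed[of a] by (simp add: ring_of_type_algebra_def)
  have add: "\<pi> n (a + b) = \<pi> n a \<oplus>\<^bsub>Bs n\<^esub> \<pi> n b" for a b
    using P.hom_add[of a b] by (simp add: ring_of_type_algebra_def)
  have mult: "\<pi> n (a * b) = \<pi> n a \<otimes>\<^bsub>Bs n\<^esub> \<pi> n b" for a b
    using P.hom_mult[of a b] by (simp add: ring_of_type_algebra_def)
  have zero: "\<pi> n 0 = \<zero>\<^bsub>Bs n\<^esub>"
    using P.hom_zero by (simp add: ring_of_type_algebra_def)
  show "is_ideal {b. \<pi> n b = \<zero>\<^bsub>Bs n\<^esub>}"
    by (auto simp: is_ideal_def add mult zero closed)
  show "\<pi> n (a - b) = \<zero>\<^bsub>Bs n\<^esub>" if "\<pi> n a = \<pi> n b"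
  proof -
    have "\<pi> n (a - b) \<oplus>\<^bsub>Bs n\<^esub> \<pi> n b = \<pi> n b" using that by (simp flip: add)
    then show ?thesis using closed by (simp add: P.S.add.l_cancel_one)
  qed
  show "\<pi> n 0 = \<zero>\<^bsub>Bs n\<^esub>" by (rule zero)
  show "\<pi> n a \<in> carrier (Bs n)" by (rule closed)
qed

lemma inverse_limit_separated:
  assumes lim: "is_inverse_limit Bs \<phi> \<pi>" and b: "\<And>n. n \<ge> 1 \<Longrightarrow> \<pi> n b = \<zero>\<^bsub>Bs n\<^esub>"
  shows "b = 0"
proof -
  have compatible: "\<forall>n\<ge>1. \<pi> n 0 \<in> carrier (Bs n) \<and> \<phi> n (\<pi> (Suc n) 0) = \<pi> n 0"
    using lim projection_closed[OF lim] by (simp add: is_inverse_limit_def)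
  have "\<forall>s. (\<forall>n\<ge>1. s n \<in> carrier (Bs n) \<and> \<phi> n (s (Suc n)) = s n)
      \<longrightarrow> (\<exists>!a. \<forall>n\<ge>1. \<pi> n a = s n)"
    using lim unfolding is_inverse_limit_def by (elim conjE)
  from mp[OF spec[OF this, of "\<lambda>n. \<pi> n 0"] compatible]
  have unique: "\<exists>!a. \<forall>n\<ge>1. \<pi> n a = \<pi> n 0" .
  have "\<forall>n\<ge>1. \<pi> n b = \<pi> n 0" using b projection_zero[OF lim] by simp
  with unique show ?thesis by (elim ex1E) metis
qed

lemma continuous_hom_substitution:
  assumes lim: "is_inverse_limit Bs \<phi> \<pi>" and \<sigma>: "continuous_hom Bs \<pi> \<sigma>"
  shows "substitution (\<lambda>n. {b. \<pi> n b = \<zero>\<^bsub>Bs n\<^esub>}) (\<sigma> fps_X) \<sigma>"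
proof
  fix n e k assume n: "(n::nat) \<ge> 1"
  have "eventually (\<lambda>m. \<pi> n (\<Sum>j<m. fps_nth e j * fps_nth (\<sigma> fps_X ^ j) k)
      = \<pi> n (fps_nth (\<sigma> e) k)) sequentially"
    using \<sigma> n by (simp add: continuous_hom_def substitutes_to_def converges_to_def)
  then show "eventually (\<lambda>m. (\<Sum>j<m. fps_nth e j * fps_nth (\<sigma> fps_X ^ j) k)
      - fps_nth (\<sigma> e) k \<in> {b. \<pi> n b = \<zero>\<^bsub>Bs n\<^esub>}) sequentially"
    by (rule eventually_mono) (simp add: projection_eqD[OF lim n])
next
  fix b assume "\<And>n. (n::nat) \<ge> 1 \<Longrightarrow> b \<in> {b. \<pi> n b = \<zero>\<^bsub>Bs n\<^esub>}"
  then show "b = 0" by (intro inverse_limit_separated[OF lim]) simp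
next
  fix n assume n: "(n::nat) \<ge> 1"
  show "is_ideal {b. \<pi> n b = \<zero>\<^bsub>Bs n\<^esub>}" by (rule is_ideal_kernel[OF lim n])
  show "fps_nth (\<sigma> fps_X) 0 ^ n \<in> {b. \<pi> n b = \<zero>\<^bsub>Bs n\<^esub>}"
    using \<sigma> n by (simp add: continuous_hom_def complete_wrt_def)
qed

theorem theorem5p6:
  fixes Bs :: "nat \<Rightarrow> 'c ring"
    and \<phi> :: "nat \<Rightarrow> 'c \<Rightarrow> 'c"
    and \<pi> :: "nat \<Rightarrow> 'b::comm_ring_1 \<Rightarrow> 'c"
    and G :: "('g, 'm) monoid_scheme"
    and \<rho> :: "'g \<Rightarrow> 'b fps \<Rightarrow> 'b fps"
  assumes "is_inverse_limit Bs \<phi> \<pi>"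
    and "group G" and "finite (carrier G)"
    and "continuous_action G Bs \<pi> \<rho>"
    and "\<And>g. g \<in> carrier G - {\<one>\<^bsub>G\<^esub>} \<Longrightarrow> \<not> is_zero_divisor (fps_nth (\<rho> g fps_X) 0)"
  shows "invariant_series G \<rho> = power_series_in (\<Prod>g\<in>carrier G. \<rho> g fps_X)"
proof -
  interpret group G by (rule assms(2))
  have aut: "continuous_aut Bs \<pi> (\<rho> g)" if "g \<in> carrier G" for g
    using assms(4) that by (auto simp: continuous_action_def hom_def Aut_c_def)
  have comp: "\<rho> (g \<otimes>\<^bsub>G\<^esub> h) f = \<rho> g (\<rho> h f)" if "g \<in> carrier G" "h \<in> carrier G" for g h f
    using assms(4) that by (auto simp: continuous_action_def hom_def Aut_c_def)
  have subst: "substitution (\<lambda>n. {b. \<pi> n b = \<zero>\<^bsub>Bs n\<^esub>}) (\<rho> g fps_X) (\<rho> g)"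
    if "g \<in> carrier G" for g
    using continuous_hom_substitution[OF assms(1)] aut[OF that] by (simp add: continuous_aut_def)
  \<comment> \<open>\<open>\<rho> \<one>\<close> is idempotent and injective.\<close>
  have one: "\<rho> \<one>\<^bsub>G\<^esub> f = f" for f
  proof (rule substitution.substitution_injective[OF subst])
    show "fps_nth (\<rho> \<one>\<^bsub>G\<^esub> fps_X) 1 dvd 1" using aut[of "\<one>\<^bsub>G\<^esub>"] by (simp add: continuous_aut_def)
    show "\<rho> \<one>\<^bsub>G\<^esub> (\<rho> \<one>\<^bsub>G\<^esub> f) = \<rho> \<one>\<^bsub>G\<^esub> f" by (simp flip: comp)
  qed simp
  interpret fps_automorphisms G \<rho>
  proof
    fix g e f c assume g: "g \<in> carrier G"
    show "\<rho> g (e + f) = \<rho> g e + \<rho> g f" "\<rho> g (e * f) = \<rho> g e * \<rho> g f"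
      "\<rho> g (fps_const c) = fps_const c"
      using subst[OF g] by (rule substitution.substitution_add substitution.substitution_mult
          substitution.substitution_const)+
  qed (fact assms(3) one comp assms(5))+
  show ?thesis using invariants_eq_power_series_in_norm_X by (simp add: norm_X_def)
qed

end
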